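(* Let $p$ be a non-zero element of $\mathbb{C}^n$. Then the set $$\mathcal{E}(p)=\{\phi_{ab}:\mathbf{Sp}(n)\to\mathbb{C}\mid \phi_{ab}(g)=\operatorname{trace}(p^t a z^t+p^t b w^t),\ a,b\in\mathbb{C}^n\}$$ of complex valued functions is an eigenfamily on $\mathbf{Sp}(n)$, where $z,w\in\mathbb{C}^{n\times n}$ are the blocks of $g=\begin{pmatrix} z & w\\ -\bar w & \bar z\end{pmatrix}\in\mathbf{Sp}(n)$.
   Context: $\mathbf{Sp}(n)$ is the quaternionic unitary group, i.e. the intersection of the unitary group $\mathbf{U}(2n)$ with the group of invertible matrices of the form $\begin{pmatrix} z & w\\ -\bar w & \bar z\end{pmatrix}\in\mathbb{C}^{2n\times 2n}$, $z,w\in\mathbb{C}^{n\times n}$ (the standard representation of $\mathbf{GL}_n(\mathbb{H})$). It carries the left-invariant Riemannian metric induced by the scalar product $\operatorname{Re}\operatorname{trace}(ZW^* )$ on its Lie algebra $\mathfrak{sp}(n)\subset\mathbb{C}^{2n\times 2n}$. Elements of $\mathbb{C}^n$ are row vectors, so $p^t a$ is an $n\times n$ complex matrix; $t$ denotes transpose without conjugation. For complex valued functions $\phi,\psi$ on a semi-Riemannian manifold $(M,g)$, $\tau(\phi)$ is the Laplacian ($\operatorname{div}\operatorname{grad}$) extended complex linearly and $\kappa(\phi,\psi)=g(\operatorname{grad}(\phi),\operatorname{grad}(\psi))$ with $g$ extended complex bilinearly. On $\mathbf{Sp}(n)$ these are $\tau(\phi)=\sum_{Z\in\mathcal{B}}Z^2(\phi)$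 and $\kappa(\phi,\psi)=\sum_{Z\in\mathcal{B}}Z(\phi)Z(\psi)$ for any orthonormal basis $\mathcal{B}$ of the Lie algebra of left-invariant vector fields. A set $\mathcal{E}$ of complex valued functions on $M$ is an eigenfamily if there exist $\lambda,\mu\in\mathbb{C}$ such that $\tau(\phi)=\lambda\phi$ and $\kappa(\phi,\psi)=\mu\,\phi\psi$ for all $\phi,\psi\in\mathcal{E}$. *)

theory Defs
  imports "HOL-Analysis.Analysis"
begin

type_synonym 'm cmat = "complex ^ 'm ^ 'm"

definition ctranspose :: "'m cmat \<Rightarrow> 'm::finite cmat" where
  "ctranspose A = (\<chi> i j. cnj (A $ j $ i))"


section \<open>The quaternionic unitary group\<close>

definition unitary_group :: "'m::finite cmat set" where
  "unitary_group = {A. A ** ctranspose A = mat 1 \<and> ctranspose A ** A = mat 1}"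

text \<open>The index type \<open>'n + 'n\<close> splits a \<open>2n \<times> 2n\<close> matrix into four \<open>n \<times> n\<close> blocks.\<close>

definition upper_left :: "('n::finite + 'n) cmat \<Rightarrow> 'n cmat" where
  "upper_left g = (\<chi> i j. g $ Inl i $ Inl j)"

definition upper_right :: "('n::finite + 'n) cmat \<Rightarrow> 'n cmat" where
  "upper_right g = (\<chi> i j. g $ Inl i $ Inr j)"

definition quaternionic_matrix :: "'n::finite cmat \<Rightarrow> 'n cmat \<Rightarrow> ('n + 'n) cmat" where
  "quaternionic_matrix z w = (\<chi> r s.
     case r of
       Inl i \<Rightarrow> (case s of Inl j \<Rightarrow> z $ i $ j | Inr j \<Rightarrow> w $ i $ j)
     | Inr i \<Rightarrow> (case s of Inl j \<Rightarrow> - cnj (w $ i $ j) | Inr j \<Rightarrow> cnj (z $ i $ j)))"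

definition GL_H :: "('n::finite + 'n) cmat set" where
  "GL_H = {g. invertible g \<and> (\<exists>z w. g = quaternionic_matrix z w)}"

definition Sp :: "('n::finite + 'n) cmat set" where
  "Sp = unitary_group \<inter> GL_H"


section \<open>The Lie algebra and left-invariant differentiation\<close>

definition mat_exp :: "'m::finite cmat \<Rightarrow> 'm cmat" where
  "mat_exp A = (\<Sum>k. (1 / fact k) *\<^sub>R (((**) A) ^^ k) (mat 1))"

text \<open>The Lie algebra of a closed matrix group, here \<open>Sp\<close>, consists of the generators of its
  one-parameter subgroups. It is a real subspace of the matrices.\<close>

definition sp_algebra :: "('n::finite + 'n) cmat set" where
  "sp_algebra = {Z. \<forall>t::real. mat_exp (t *\<^sub>R Z) \<in> Sp}"

text \<open>The action \<open>Z(\<phi>)\<close> of the left-invariant vector field with value \<open>Z\<close> at the identity. At a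
  point \<open>g \<in> Sp\<close> it depends only on the values of \<open>\<phi>\<close> on \<open>Sp\<close>.\<close>

definition left_deriv ::
    "('n::finite + 'n) cmat \<Rightarrow> (('n + 'n) cmat \<Rightarrow> complex) \<Rightarrow> ('n + 'n) cmat \<Rightarrow> complex" where
  "left_deriv Z \<phi> g = vector_derivative (\<lambda>t. \<phi> (g ** mat_exp (t *\<^sub>R Z))) (at 0)"

text \<open>Left-invariant vector fields span every tangent space, so a function on the group is smooth
  iff all its iterated left-invariant derivatives exist and are continuous. The fields in the list
  are applied from the last one to the first one.\<close>

definition smooth_on_Sp :: "(('n::finite + 'n) cmat \<Rightarrow> complex) \<Rightarrow> bool" where
  "smooth_on_Sp \<phi> \<longleftrightarrow> (\<forall>Zs. set Zs \<subseteq> sp_algebra \<longrightarrow>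
     continuous_on Sp (foldr left_deriv Zs \<phi>) \<and>
     (\<forall>g\<in>Sp. \<forall>Z\<in>sp_algebra.
        (\<lambda>t. foldr left_deriv Zs \<phi> (g ** mat_exp (t *\<^sub>R Z))) differentiable (at 0)))"


section \<open>The Riemannian metric and eigenfamilies\<close>

definition sp_inner :: "('n::finite + 'n) cmat \<Rightarrow> ('n + 'n) cmat \<Rightarrow> real" where
  "sp_inner Z W = Re (trace (Z ** ctranspose W))"

definition sp_orthonormal_basis :: "('n::finite + 'n) cmat set \<Rightarrow> bool" where
  "sp_orthonormal_basis B \<longleftrightarrow> finite B \<and> B \<subseteq> sp_algebra \<and> span B = sp_algebra \<and>
     (\<forall>Z\<in>B. \<forall>W\<in>B. sp_inner Z W = (if Z = W then 1 else 0))"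

text \<open>The Laplacian \<open>\<tau>\<close> and the conformality operator \<open>\<kappa>\<close> are given by sums that take the same
  value for every orthonormal basis; the definite description picks out that common value.\<close>

definition tau :: "(('n::finite + 'n) cmat \<Rightarrow> complex) \<Rightarrow> ('n + 'n) cmat \<Rightarrow> complex" where
  "tau \<phi> g = (THE c. \<forall>B. sp_orthonormal_basis B \<longrightarrow>
     c = (\<Sum>Z\<in>B. left_deriv Z (left_deriv Z \<phi>) g))"

definition kappa ::
    "(('n::finite + 'n) cmat \<Rightarrow> complex) \<Rightarrow> (('n + 'n) cmat \<Rightarrow> complex) \<Rightarrow> ('n + 'n) cmat \<Rightarrow> complex"
  where
  "kappa \<phi> \<psi> g = (THE c. \<forall>B. sp_orthonormal_basis B \<longrightarrow>
     c = (\<Sum>Z\<in>B. left_deriv Z \<phi> g * left_deriv Z \<psi> g))"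

text \<open>Smoothness is part of the definition because \<open>\<tau>\<close> and \<open>\<kappa>\<close> are meaningful only for
  differentiable functions, whereas \<^const>\<open>vector_derivative\<close> is total.\<close>

definition eigenfamily_on_Sp :: "(('n::finite + 'n) cmat \<Rightarrow> complex) set \<Rightarrow> bool" where
  "eigenfamily_on_Sp E \<longleftrightarrow> (\<forall>\<phi>\<in>E. smooth_on_Sp \<phi>) \<and>
     (\<exists>l m :: complex. \<forall>\<phi>\<in>E. \<forall>\<psi>\<in>E. \<forall>g\<in>Sp.
        tau \<phi> g = l * \<phi> g \<and> kappa \<phi> \<psi> g = m * \<phi> g * \<psi> g)"


section \<open>The functions\<close>

text \<open>\<open>p\<^sup>t a\<close> for row vectors \<open>p\<close>, \<open>a\<close>, i.e. a column times a row.\<close>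

definition col_times_row :: "complex ^ 'n \<Rightarrow> complex ^ 'n \<Rightarrow> 'n::finite cmat" where
  "col_times_row p a = transpose (rowvector p :: complex ^ 'n ^ 1) ** rowvector a"

definition phi ::
    "complex ^ 'n \<Rightarrow> complex ^ 'n \<Rightarrow> complex ^ 'n \<Rightarrow> ('n::finite + 'n) cmat \<Rightarrow> complex" where
  "phi p a b = (\<lambda>g\<in>Sp. trace (col_times_row p a ** transpose (upper_left g)
                            + col_times_row p b ** transpose (upper_right g)))"

end

theory Submission
  imports Defs
begin

text \<open>Let \<open>J\<close> be the standard symplectic matrix and \<open>E\<^sub>i\<^sub>j\<close> the matrix units. Expanding the orthogonal
  projection of \<open>c E\<^sub>i\<^sub>j\<close> to the Lie algebra in an orthonormal basis \<open>B\<close>, for \<open>c = 1\<close> and \<open>c = \<i>\<close>, gives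
  \<open>\<Sum>Z\<in>B. Z\<^sub>i\<^sub>j Z = - (E\<^sub>j\<^sub>i + J E\<^sub>i\<^sub>j J) / 2\<close>. The functions of the family are matrix coefficients
  \<open>g \<mapsto> x\<^sup>t g v\<close> with one common vector \<open>x\<close>, and \<open>Z\<close> acts on them by replacing \<open>v\<close> with \<open>Z v\<close>. So the
  Laplacian acts through \<open>\<Sum>Z\<in>B. Z\<^sup>2 = - (2n + 1) / 2\<close>, and in the conformality operator the part
  containing \<open>J\<close> is a multiple of \<open>y\<^sup>t J y = 0\<close>, where \<open>y\<^sup>t = x\<^sup>t g\<close>. Hence \<open>\<lambda> = - (2n + 1) / 2\<close> and
  \<open>\<mu> = - 1 / 2\<close>.\<close>

section \<open>The matrix exponential\<close>

lemma bounded_bilinear_cmat_mult: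
  "bounded_bilinear ((**) :: 'm::finite cmat \<Rightarrow> 'm cmat \<Rightarrow> 'm cmat)"
proof -
  have "linear (\<lambda>B :: 'm cmat. A ** B)" "linear (\<lambda>B :: 'm cmat. B ** A)" for A :: "'m cmat"
    by (auto intro!: linearI simp: matrix_matrix_mult_def vec_eq_iff sum.distrib
        algebra_simps scaleR_sum_right)
  then have "bilinear ((**) :: 'm cmat \<Rightarrow> 'm cmat \<Rightarrow> 'm cmat)"
    by (simp add: bilinear_def)
  then show ?thesis
    by (simp add: bilinear_conv_bounded_bilinear)
qed

interpretation cmat_mult:
  bounded_bilinear "(**) :: 'm::finite cmat \<Rightarrow> 'm cmat \<Rightarrow> 'm cmat"
  by (rule bounded_bilinear_cmat_mult)

abbreviation matpow :: "'m::finite cmat \<Rightarrow> nat \<Rightarrow> 'm cmat" where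
  "matpow A k \<equiv> (((**) A) ^^ k) (mat 1)"

lemma matpow_scaleR: "matpow (t *\<^sub>R A) k = t ^ k *\<^sub>R matpow A k"
  by (induction k) (simp_all add: cmat_mult.scaleR_left cmat_mult.scaleR_right)

text \<open>A geometric bound on the powers is what allows the exponential series, as a matrix and
  entry by entry, to be compared with a scalar exponential series.\<close>

lemma matpow_norm_bound:
  fixes A :: "'m::finite cmat"
  obtains C where "\<And>k. norm (matpow A k) \<le> norm (mat 1 :: 'm cmat) * C ^ k"
proof -
  \<comment> \<open>\<open>K\<close> is the constant from the boundedness of matrix multiplication,
    so each further factor \<open>A\<close> costs at most \<open>norm A * K\<close>.\<close>
  obtain K where K: "\<And>(B :: 'm cmat) (D :: 'm cmat). norm (B ** D) \<le> norm B * norm D * K" "0 \<le> K"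
    using cmat_mult.nonneg_bounded[where 'm = 'm] by metis
  have "norm (matpow A k) \<le> norm (mat 1 :: 'm cmat) * (norm A * K) ^ k" for k
  proof (induction k)
    case (Suc k)
    have "norm (matpow A (Suc k)) \<le> norm A * norm (matpow A k) * K"
      using K(1) by simp
    also have "\<dots> \<le> norm A * (norm (mat 1 :: 'm cmat) * (norm A * K) ^ k) * K"
      by (intro mult_right_mono mult_left_mono Suc K(2)) auto
    finally show ?case by (simp add: mult_ac)
  qed simp
  then show thesis using that by blast
qed

lemma summable_mat_exp: "summable (\<lambda>k. (1 / fact k) *\<^sub>R matpow (A :: 'm::finite cmat) k)"
proof -
  obtain C where C: "\<And>k. norm (matpow A k) \<le> norm (mat 1 :: 'm cmat) * C ^ k"
    by (rule matpow_norm_bound[of A]) blast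
  show ?thesis
  proof (rule summable_comparison_test'[where N = 0])
    show "summable (\<lambda>k. norm (mat 1 :: 'm cmat) * (inverse (fact k) * C ^ k))"
      by (intro summable_mult summable_exp)
    show "norm ((1 / fact k) *\<^sub>R matpow A k) \<le> norm (mat 1 :: 'm cmat) * (inverse (fact k) * C ^ k)"
      for k
      using mult_left_mono[OF C[of k], of "inverse (fact k)"]
      by (simp add: field_simps)
  qed
qed

text \<open>The variable \<open>y\<close> is complex so that each entry of the exponential becomes
  an everywhere convergent complex power series, which can be differentiated term by term.\<close>

lemma summable_mat_exp_entry:
  "summable (\<lambda>k. of_real (1 / fact k) * matpow (A :: 'm::finite cmat) k $ i $ j * y ^ k)"
proof -
  obtain C where C: "\<And>k. norm (matpow A k) \<le> norm (mat 1 :: 'm cmat) * C ^ k"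
    by (rule matpow_norm_bound[of A]) blast
  show ?thesis
  proof (rule summable_comparison_test'[where N = 0])
    show "summable (\<lambda>k. norm (mat 1 :: 'm cmat) * (inverse (fact k) * (C * norm y) ^ k))"
      by (intro summable_mult summable_exp)
    show "norm (of_real (1 / fact k) * matpow A k $ i $ j * y ^ k)
        \<le> norm (mat 1 :: 'm cmat) * (inverse (fact k) * (C * norm y) ^ k)" for k
    proof -
      have "norm (matpow A k $ i $ j) \<le> norm (matpow A k)"
        by (rule order_trans[OF Finite_Cartesian_Product.norm_nth_le
              Finite_Cartesian_Product.norm_nth_le])
      also note C[of k]
      finally have "norm (matpow A k $ i $ j) \<le> norm (mat 1 :: 'm cmat) * C ^ k" .
      from mult_right_mono[OF this, of "inverse (fact k) * norm y ^ k"] show ?thesis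
        by (simp add: norm_mult norm_power norm_divide field_simps power_mult_distrib)
    qed
  qed
qed

lemma mat_exp_scaleR_entry:
  "mat_exp (t *\<^sub>R A) $ i $ j
    = (\<Sum>k. of_real (1 / fact k) * matpow (A :: 'm::finite cmat) k $ i $ j * of_real t ^ k)"
proof -
  have "bounded_linear (\<lambda>M :: 'm cmat. M $ i $ j)"
    using bounded_linear_compose[OF bounded_linear_vec_nth bounded_linear_vec_nth] .
  from bounded_linear.suminf[OF this summable_mat_exp[of "t *\<^sub>R A"]]
  show ?thesis
    by (simp add: mat_exp_def matpow_scaleR scaleR_conv_of_real[where 'a = complex] mult_ac)
qed

text \<open>A vector is the sum of its components placed on the axes, and placing on an axis is
  bounded linear. Used for rows and then for entries, this reduces matrix derivatives to scalar
  ones.\<close>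

lemma has_vector_derivative_vec:
  fixes f :: "real \<Rightarrow> 'b::euclidean_space ^ 'n::finite"
  assumes "\<And>i. ((\<lambda>t. f t $ i) has_vector_derivative d $ i) F"
  shows "(f has_vector_derivative d) F"
proof -
  have axis: "x = (\<Sum>i\<in>UNIV. axis i (x $ i))" for x :: "'b ^ 'n"
    by (simp add: vec_eq_iff axis_def)
  have "bounded_linear (axis i :: 'b \<Rightarrow> 'b ^ 'n)" for i
    unfolding linear_conv_bounded_linear[symmetric]
    by (rule linearI) (auto simp: axis_def vec_eq_iff)
  then have "((\<lambda>t. axis i (f t $ i) :: 'b ^ 'n) has_vector_derivative axis i (d $ i)) F" for i
    by (rule bounded_linear.has_vector_derivative) (rule assms)
  then have "((\<lambda>t. \<Sum>i\<in>UNIV. axis i (f t $ i)) has_vector_derivative (\<Sum>i\<in>UNIV. axis i (d $ i))) F"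
    by (rule has_vector_derivative_sum)
  then show ?thesis
    by (simp only: axis[symmetric])
qed

lemma mat_exp_has_vector_derivative:
  "((\<lambda>t. mat_exp (t *\<^sub>R A)) has_vector_derivative A ** mat_exp (t *\<^sub>R A)) (at t)"
  for A :: "'m::finite cmat"
proof (intro has_vector_derivative_vec)
  fix i j
  let ?c = "\<lambda>k. of_real (1 / fact k) * matpow A k $ i $ j"
  let ?f = "\<lambda>x. \<Sum>k. ?c k * x ^ k"
  have "bounded_linear (\<lambda>M :: 'm cmat. (A ** M) $ i $ j)"
    using bounded_linear_compose[OF bounded_linear_compose[OF bounded_linear_vec_nth bounded_linear_vec_nth]
        cmat_mult.bounded_linear_right] .
  from bounded_linear.suminf[OF this summable_mat_exp[of "t *\<^sub>R A"]]
  have "(A ** mat_exp (t *\<^sub>R A)) $ i $ j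
      = (\<Sum>k. of_real (1 / fact k) * matpow A (Suc k) $ i $ j * of_real t ^ k)"
    by (simp add: mat_exp_def matpow_scaleR cmat_mult.scaleR_right scaleR_conv_of_real[where 'a = complex] mult_ac)
  \<comment> \<open>The factor \<open>Suc k\<close> in \<open>diffs\<close> cancels against
    \<open>fact (Suc k)\<close>, leaving \<open>1 / fact k\<close> in front of the power
    \<open>Suc k\<close> of \<open>A\<close>.\<close>
  also have "\<dots> = (\<Sum>k. diffs ?c k * of_real t ^ k)"
    by (simp add: diffs_def field_simps del: of_nat_Suc funpow.simps)
  finally have eq: "(\<Sum>k. diffs ?c k * of_real t ^ k) = (A ** mat_exp (t *\<^sub>R A)) $ i $ j" ..
  have "(?f has_field_derivative (\<Sum>k. diffs ?c k * of_real t ^ k)) (at (of_real t))"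
    by (intro termdiffs_strong_converges_everywhere summable_mat_exp_entry)
  from has_vector_derivative_real_field[OF this]
  show "((\<lambda>t. mat_exp (t *\<^sub>R A) $ i $ j) has_vector_derivative (A ** mat_exp (t *\<^sub>R A)) $ i $ j) (at t)"
    by (simp only: eq mat_exp_scaleR_entry)
qed

lemma mat_exp_0: "mat_exp 0 = (mat 1 :: 'm::finite cmat)"
proof -
  \<comment> \<open>Zero is written as \<open>0 *\<^sub>R 0\<close> so that the power series of the
    entries applies; at 0 only its constant term remains.\<close>
  have "mat_exp (0 *\<^sub>R 0 :: 'm cmat) $ i $ j = (mat 1 :: 'm cmat) $ i $ j" for i j
    unfolding mat_exp_scaleR_entry of_real_0 by (subst powser_zero) simp
  then show ?thesis
    by (simp add: vec_eq_iff)
qed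

text \<open>The partial sums stay in \<open>S\<close>, and a subspace is closed in finite
  dimension.\<close>

lemma mat_exp_in_subspace:
  assumes "subspace S" "\<And>k. matpow A k \<in> S"
  shows "mat_exp (A :: 'm::finite cmat) \<in> S"
proof (rule Lim_in_closed_set)
  show "closed S"
    using assms(1) by (rule closed_subspace)
  show "(\<lambda>n. \<Sum>k<n. (1 / fact k) *\<^sub>R matpow A k) \<longlonglongrightarrow> mat_exp A"
    using summable_LIMSEQ[OF summable_mat_exp] by (simp add: mat_exp_def)
  show "\<forall>\<^sub>F n in sequentially. (\<Sum>k<n. (1 / fact k) *\<^sub>R matpow A k) \<in> S"
    using assms by (intro always_eventually allI subspace_sum subspace_scale)
qed simp

lemma has_vector_derivative_mat_exp_linear:
  fixes g Z :: "'m::finite cmat"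
  assumes "bounded_linear L"
  shows "((\<lambda>t. L (g ** mat_exp (t *\<^sub>R Z))) has_vector_derivative L (g ** Z)) (at 0)"
proof -
  have "((\<lambda>t. mat_exp (t *\<^sub>R Z)) has_vector_derivative Z) (at 0)"
    using mat_exp_has_vector_derivative[of Z 0] by (simp add: mat_exp_0)
  from bounded_linear.has_vector_derivative[OF cmat_mult.bounded_linear_right this]
  show ?thesis
    by (rule bounded_linear.has_vector_derivative[OF assms])
qed


section \<open>The Lie algebra\<close>

lemma bounded_linear_ctranspose: "bounded_linear (ctranspose :: 'm::finite cmat \<Rightarrow> _)"
  unfolding linear_conv_bounded_linear[symmetric]
  by (rule linearI) (simp_all add: ctranspose_def vec_eq_iff)

lemma ctranspose_mult: "ctranspose (A ** B) = ctranspose B ** ctranspose (A :: 'm::finite cmat)"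
  by (simp add: ctranspose_def matrix_matrix_mult_def vec_eq_iff mult.commute)

lemma ctranspose_mat_1: "ctranspose (mat 1) = (mat 1 :: 'm::finite cmat)"
  by (simp add: ctranspose_def mat_def vec_eq_iff)

lemma unitary_group_iff: "A \<in> unitary_group \<longleftrightarrow> ctranspose A ** A = mat 1"
  unfolding unitary_group_def using matrix_left_right_inverse by blast

text \<open>As the derivative of the exponential carries \<open>Z\<close> on the left, the product
  rule puts \<open>ctranspose Z\<close> and \<open>Z\<close> side by side between the two
  exponentials.\<close>

lemma gram_mat_exp_derivative:
  "((\<lambda>t. ctranspose (mat_exp (t *\<^sub>R Z)) ** mat_exp (t *\<^sub>R Z)) has_vector_derivative
     ctranspose (mat_exp (t *\<^sub>R Z)) ** (ctranspose Z + Z) ** mat_exp (t *\<^sub>R Z)) (at t)"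
  for Z :: "'m::finite cmat"
proof -
  note d = mat_exp_has_vector_derivative[of Z t]
  show ?thesis
    using cmat_mult.has_vector_derivative[OF bounded_linear.has_vector_derivative
        [OF bounded_linear_ctranspose d] d]
    by (simp add: ctranspose_mult matrix_mul_assoc cmat_mult.add_left cmat_mult.add_right add.commute)
qed

text \<open>If the Gram matrix is constantly \<open>mat 1\<close>, its derivative at 0 vanishes,
  which is the skew-Hermitian condition. Conversely that condition makes the derivative vanish for
  all \<open>t\<close>, so the Gram matrix keeps its value at 0.\<close>

lemma mat_exp_unitary_iff:
  "(\<forall>t. mat_exp (t *\<^sub>R Z) \<in> unitary_group) \<longleftrightarrow> ctranspose Z = - (Z :: 'm::finite cmat)"
proof
  assume "\<forall>t. mat_exp (t *\<^sub>R Z) \<in> unitary_group"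
  then have "((\<lambda>t. mat 1) has_vector_derivative ctranspose Z + Z) (at (0::real))"
    using gram_mat_exp_derivative[of Z 0]
    by (simp add: unitary_group_iff mat_exp_0 ctranspose_mat_1)
  then have "ctranspose Z + Z = 0"
    using has_vector_derivative_const vector_derivative_unique_at by blast
  then show "ctranspose Z = - Z"
    by (rule eq_neg_iff_add_eq_0[THEN iffD2])
next
  assume Z: "ctranspose Z = - Z"
  let ?F = "\<lambda>t. ctranspose (mat_exp (t *\<^sub>R Z)) ** mat_exp (t *\<^sub>R Z)"
  have "(?F has_derivative (\<lambda>h. 0)) (at t within UNIV)" for t
    using gram_mat_exp_derivative[of Z t] Z
    by (simp add: has_vector_derivative_def cmat_mult.zero_left cmat_mult.zero_right)
  then obtain c where "\<And>t. ?F t = c"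
    using has_derivative_zero_constant[of UNIV ?F] by auto
  then have "?F t = ?F 0" for t by metis
  then show "\<forall>t. mat_exp (t *\<^sub>R Z) \<in> unitary_group"
    by (simp add: unitary_group_iff mat_exp_0 ctranspose_mat_1)
qed

section \<open>Quaternionic matrices and their exponentials\<close>

fun swap_index :: "'n + 'n \<Rightarrow> 'n + 'n" where
  "swap_index (Inl i) = Inr i"
| "swap_index (Inr i) = Inl i"

text \<open>Together with \<open>swap_index\<close> this encodes the symplectic matrix J as a signed
  permutation: the only nonzero entry of row \<open>r\<close> is \<open>index_sign r\<close>, in
  column \<open>swap_index r\<close>.\<close>

fun index_sign :: "'n + 'n \<Rightarrow> complex" where
  "index_sign (Inl i) = 1"
| "index_sign (Inr i) = -1"

lemma swap_index_swap_index [simp]: "swap_index (swap_index r) = r"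
  by (cases r) auto

lemma swap_index_eq_iff [simp]: "swap_index r = swap_index s \<longleftrightarrow> r = s"
  by (metis swap_index_swap_index)

lemma bij_swap_index: "bij swap_index"
  by (rule involuntory_imp_bij) simp

lemma sum_swap_index: "(\<Sum>r\<in>UNIV. f (swap_index r)) = (\<Sum>r\<in>UNIV. f r)"
  using sum.reindex_bij_betw[OF bij_swap_index] .

lemma index_sign_swap [simp]: "index_sign (swap_index r) = - index_sign r"
  by (cases r) auto

lemma index_sign_square [simp]: "index_sign r * index_sign r = 1"
  by (cases r) auto

lemma index_sign_square_left [simp]: "index_sign r * (index_sign r * x) = x"
  by (cases r) auto

lemma cnj_index_sign [simp]: "cnj (index_sign r) = index_sign r"
  by (cases r) auto

text \<open>With \<open>J\<close> the standard symplectic matrix, this is the condition \<open>J Z = cnj Z J\<close>.\<close>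

definition quat_matrices :: "('n::finite + 'n) cmat set" where
  "quat_matrices = {A. \<forall>r s. A $ swap_index r $ swap_index s
     = index_sign r * index_sign s * cnj (A $ r $ s)}"

lemma subspace_quat_matrices: "subspace quat_matrices"
  by (auto simp: subspace_def quat_matrices_def algebra_simps scaleR_conv_of_real[where 'a = complex])

text \<open>After reindexing the sum by \<open>swap_index\<close>, the sign of the summation index
  occurs twice and cancels.\<close>

lemma quat_matrices_mult:
  assumes "A \<in> quat_matrices" "B \<in> quat_matrices"
  shows "A ** B \<in> quat_matrices"
proof -
  have "(A ** B) $ swap_index r $ swap_index s
      = index_sign r * index_sign s * cnj ((A ** B) $ r $ s)" for r s
  proof -
    have "(A ** B) $ swap_index r $ swap_index s
        = (\<Sum>k\<in>UNIV. A $ swap_index r $ swap_index k * B $ swap_index k $ swap_index s)"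
      by (simp add: matrix_matrix_mult_def
          sum_swap_index[of "\<lambda>k. A $ swap_index r $ k * B $ k $ swap_index s"])
    also have "\<dots> = index_sign r * index_sign s * cnj ((A ** B) $ r $ s)"
      using assms by (simp add: quat_matrices_def matrix_matrix_mult_def sum_distrib_left mult_ac)
    finally show ?thesis .
  qed
  then show ?thesis by (simp add: quat_matrices_def)
qed

lemma mat_1_in_quat_matrices: "mat 1 \<in> quat_matrices"
  by (auto simp: quat_matrices_def mat_def)

text \<open>The symmetry determines the two lower blocks from the two upper ones, which serve as the
  witnesses \<open>z\<close> and \<open>w\<close>.\<close>

lemma quaternionic_matrix_image:
  "(\<exists>z w. g = quaternionic_matrix z w) \<longleftrightarrow> g \<in> quat_matrices"
proof
  assume "\<exists>z w. g = quaternionic_matrix z w"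
  then show "g \<in> quat_matrices"
    by (auto simp: quat_matrices_def quaternionic_matrix_def split: sum.split)
next
  assume "g \<in> quat_matrices"
  then have g: "g $ swap_index r $ swap_index s = index_sign r * index_sign s * cnj (g $ r $ s)" for r s
    by (simp add: quat_matrices_def)
  have "g = quaternionic_matrix (upper_left g) (upper_right g)"
    using g[of "Inl _" "Inl _"] g[of "Inl _" "Inr _"]
    by (auto simp: vec_eq_iff quaternionic_matrix_def upper_left_def upper_right_def split: sum.split)
  then show "\<exists>z w. g = quaternionic_matrix z w" by blast
qed

lemma Sp_eq: "Sp = unitary_group \<inter> quat_matrices"
  unfolding Sp_def GL_H_def quaternionic_matrix_image
  by (auto simp: unitary_group_def invertible_def)

lemma Sp_mult:
  assumes "g \<in> Sp" "h \<in> Sp"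
  shows "g ** h \<in> Sp"
proof -
  have "ctranspose (g ** h) ** (g ** h) = ctranspose h ** (ctranspose g ** g) ** h"
    by (simp add: ctranspose_mult matrix_mul_assoc)
  then show ?thesis
    using assms by (simp add: Sp_eq unitary_group_iff quat_matrices_mult)
qed

text \<open>The quaternionic matrices form a subspace closed under multiplication, so they contain
  all powers of \<open>Z\<close> and hence the exponential. For the converse the linear equations
  defining them are differentiated at 0.\<close>

lemma mat_exp_quat_iff:
  fixes Z :: "('n::finite + 'n) cmat"
  shows "(\<forall>t. mat_exp (t *\<^sub>R Z) \<in> quat_matrices) \<longleftrightarrow> Z \<in> quat_matrices"
proof
  assume Z: "Z \<in> quat_matrices"
  show "\<forall>t. mat_exp (t *\<^sub>R Z) \<in> quat_matrices"
  proof (intro allI mat_exp_in_subspace[OF subspace_quat_matrices])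
    show "matpow (t *\<^sub>R Z) k \<in> quat_matrices" for t k
      by (induction k)
        (simp_all add: mat_1_in_quat_matrices quat_matrices_mult Z
          subspace_scale[OF subspace_quat_matrices])
  qed
next
  assume exp: "\<forall>t. mat_exp (t *\<^sub>R Z) \<in> quat_matrices"
  have "Z $ swap_index r $ swap_index s - index_sign r * index_sign s * cnj (Z $ r $ s) = 0" for r s
  proof -
    \<comment> \<open>This map is linear over the reals only, because of the conjugation; that
      suffices for a derivative in the real variable \<open>t\<close>.\<close>
    let ?L = "\<lambda>A. A $ swap_index r $ swap_index s - index_sign r * index_sign s * cnj (A $ r $ s)"
    have "bounded_linear ?L"
      unfolding linear_conv_bounded_linear[symmetric]
      by (rule linearI) (simp_all add: algebra_simps scaleR_conv_of_real[where 'a = complex])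
    from has_vector_derivative_mat_exp_linear[OF this, of "mat 1" Z]
    have "((\<lambda>t. 0) has_vector_derivative ?L Z) (at (0::real))"
      using exp by (simp add: quat_matrices_def)
    then show ?thesis
      using has_vector_derivative_const vector_derivative_unique_at by blast
  qed
  then show "Z \<in> quat_matrices" by (simp add: quat_matrices_def)
qed

text \<open>Both conditions on the one-parameter subgroup have become real linear equations in
  \<open>Z\<close>.\<close>

lemma sp_algebra_eq: "sp_algebra = {Z. ctranspose Z = - Z} \<inter> quat_matrices"
  by (auto simp: sp_algebra_def Sp_eq all_conj_distrib mat_exp_unitary_iff mat_exp_quat_iff)

lemma subspace_sp_algebra: "subspace sp_algebra"
  unfolding sp_algebra_eq
  by (rule subspace_inter[OF _ subspace_quat_matrices])
    (auto simp: subspace_def linear_simps[OF bounded_linear_ctranspose])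


section \<open>The Casimir element\<close>

text \<open>The metric is the Euclidean inner product of the matrix space, so the general results on
  orthonormal bases of subspaces apply.\<close>

lemma sp_inner_eq_inner: "sp_inner Z W = Z \<bullet> W"
  by (simp add: sp_inner_def trace_def matrix_matrix_mult_def ctranspose_def inner_vec_def
      inner_complex_def)

lemma sp_orthonormal_basis_exists:
  obtains B where "sp_orthonormal_basis (B :: ('n::finite + 'n) cmat set)"
proof -
  obtain B :: "('n + 'n) cmat set" where B: "B \<subseteq> sp_algebra" "pairwise orthogonal B"
    "\<And>Z. Z \<in> B \<Longrightarrow> norm Z = 1" "independent B" "span B = sp_algebra"
    by (rule orthonormal_basis_subspace[OF subspace_sp_algebra]) blast
  then have "sp_orthonormal_basis B"
    by (auto simp: sp_orthonormal_basis_def sp_inner_eq_inner independent_imp_finite norm_eq_1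
        pairwise_def orthogonal_def)
  then show thesis by (rule that)
qed

text \<open>Existence of one basis gives uniqueness in the definite description; without it every
  \<open>c\<close> would satisfy the condition vacuously.\<close>

lemma the_orthonormal_basis_value:
  assumes "\<And>B :: ('n::finite + 'n) cmat set. sp_orthonormal_basis B \<Longrightarrow> F B = c"
  shows "(THE c. \<forall>B. sp_orthonormal_basis B \<longrightarrow> c = F B) = c"
proof -
  obtain B :: "('n + 'n) cmat set" where "sp_orthonormal_basis B"
    by (rule sp_orthonormal_basis_exists)
  with assms show ?thesis
    by (intro the_equality) auto
qed

lemma sp_orthonormal_basis_expand:
  assumes "sp_orthonormal_basis B" "A \<in> sp_algebra"
  shows "(\<Sum>Z\<in>B. (Z \<bullet> A) *\<^sub>R Z) = A"
proof -
  have "(\<Sum>Z\<in>B. (A \<bullet> Z) *\<^sub>R Z) = A"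
    by (rule orthonormal_basis_expand)
      (use assms in \<open>auto simp: sp_orthonormal_basis_def sp_inner_eq_inner norm_eq_1
        pairwise_def orthogonal_def\<close>)
  then show ?thesis
    by (simp add: inner_commute)
qed

text \<open>The coefficient \<open>c\<close> is an argument because the inner product is real: the
  matrix units with \<open>c = 1\<close> and \<open>c = \<i>\<close> are different real
  directions.\<close>

definition matrix_unit :: "'m \<Rightarrow> 'm \<Rightarrow> complex \<Rightarrow> 'm::finite cmat" where
  "matrix_unit i j c = (\<chi> r s. if r = i \<and> s = j then c else 0)"

lemma inner_matrix_unit: "Z \<bullet> matrix_unit i j c = Z $ i $ j \<bullet> c"
proof -
  have "Z \<bullet> matrix_unit i j c = (\<Sum>r\<in>UNIV. if r = i then Z $ i $ j \<bullet> c else 0)"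
    unfolding inner_vec_def matrix_unit_def
    by (rule sum.cong) (auto simp: if_distrib cong: if_cong)
  then show ?thesis by simp
qed

lemma ctranspose_matrix_unit: "ctranspose (matrix_unit i j c) = matrix_unit j i (cnj c)"
  by (auto simp: ctranspose_def matrix_unit_def vec_eq_iff)

text \<open>The orthogonal projection of \<open>matrix_unit i j c\<close> to the Lie algebra.\<close>

definition sp_projection_unit ::
    "'n + 'n \<Rightarrow> 'n + 'n \<Rightarrow> complex \<Rightarrow> ('n::finite + 'n) cmat" where
  "sp_projection_unit i j c = (1 / 4) *\<^sub>R (matrix_unit i j c - matrix_unit j i (cnj c)
     + matrix_unit (swap_index i) (swap_index j) (index_sign i * index_sign j * cnj c)
     - matrix_unit (swap_index j) (swap_index i) (index_sign i * index_sign j * c))"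

lemma matrix_unit_swap_index:
  "matrix_unit i j c $ swap_index r $ swap_index s = matrix_unit (swap_index i) (swap_index j) c $ r $ s"
  using swap_index_swap_index by (auto simp: matrix_unit_def)

lemma index_sign_matrix_unit:
  "index_sign r * index_sign s * cnj (matrix_unit i j c $ r $ s)
    = matrix_unit i j (index_sign i * index_sign j * cnj c) $ r $ s"
  by (simp add: matrix_unit_def)

text \<open>The four terms form an orbit: up to sign \<open>ctranspose\<close> exchanges the first
  with the second and the third with the fourth, and the quaternionic symmetry exchanges the first
  with the third and the second with the fourth.\<close>

lemma sp_projection_unit_in_sp_algebra: "sp_projection_unit i j c \<in> sp_algebra"
proof -
  have "ctranspose (sp_projection_unit i j c) = - sp_projection_unit i j c"
    by (simp add: sp_projection_unit_def linear_simps[OF bounded_linear_ctranspose]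
        ctranspose_matrix_unit mult.commute algebra_simps)
  moreover have "sp_projection_unit i j c $ swap_index r $ swap_index s
      = index_sign r * index_sign s * cnj (sp_projection_unit i j c $ r $ s)" for r s
  proof -
    have "index_sign r * index_sign s * cnj (sp_projection_unit i j c $ r $ s)
        = (1 / 4) *\<^sub>R (index_sign r * index_sign s * cnj (matrix_unit i j c $ r $ s)
          - index_sign r * index_sign s * cnj (matrix_unit j i (cnj c) $ r $ s)
          + index_sign r * index_sign s * cnj (matrix_unit (swap_index i) (swap_index j)
              (index_sign i * index_sign j * cnj c) $ r $ s)
          - index_sign r * index_sign s * cnj (matrix_unit (swap_index j) (swap_index i)
              (index_sign i * index_sign j * c) $ r $ s))"
      by (simp add: sp_projection_unit_def algebra_simps)
    also have "\<dots> = sp_projection_unit i j c $ swap_index r $ swap_index s"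
      unfolding index_sign_matrix_unit
      by (simp add: sp_projection_unit_def matrix_unit_swap_index mult_ac)
    finally show ?thesis by (rule sym)
  qed
  ultimately show ?thesis
    by (simp add: sp_algebra_eq quat_matrices_def)
qed

text \<open>By the symmetries of \<open>Z\<close> all four terms have the same inner product with
  \<open>Z\<close>, and the factor \<open>1 / 4\<close> averages them.\<close>

lemma inner_sp_projection_unit:
  assumes "Z \<in> sp_algebra"
  shows "Z \<bullet> sp_projection_unit i j c = Z $ i $ j \<bullet> c"
proof -
  have "cnj (Z $ i $ j) = - Z $ j $ i"
    using assms by (auto simp: sp_algebra_eq ctranspose_def vec_eq_iff)
  then have 1: "Z $ j $ i = - cnj (Z $ i $ j)"
    by simp
  have 2: "Z $ swap_index r $ swap_index s = index_sign r * index_sign s * cnj (Z $ r $ s)" for r s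
    using assms by (auto simp: sp_algebra_eq quat_matrices_def)
  show ?thesis
    unfolding sp_projection_unit_def
    by (simp add: inner_add_right inner_diff_right inner_matrix_unit 2 1)
      (cases i; cases j; simp add: inner_complex_def)
qed

lemma sum_basis_entries:
  assumes "sp_orthonormal_basis B"
  shows "(\<Sum>Z\<in>B. Z $ i $ j * Z $ k $ l) = - (1 / 2) * ((if k = j \<and> l = i then 1 else 0)
     - (if k = swap_index i \<and> l = swap_index j then index_sign i * index_sign j else 0))"
proof -
  have expand: "(\<Sum>Z\<in>B. of_real (Z $ i $ j \<bullet> c) * Z $ k $ l) = sp_projection_unit i j c $ k $ l" for c
  proof -
    have "(\<Sum>Z\<in>B. (Z $ i $ j \<bullet> c) *\<^sub>R Z) = (\<Sum>Z\<in>B. (Z \<bullet> sp_projection_unit i j c) *\<^sub>R Z)"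
      using assms by (intro sum.cong) (auto simp: inner_sp_projection_unit sp_orthonormal_basis_def)
    also have "\<dots> = sp_projection_unit i j c"
      using sp_orthonormal_basis_expand[OF assms sp_projection_unit_in_sp_algebra] .
    finally have "(\<Sum>Z\<in>B. (Z $ i $ j \<bullet> c) *\<^sub>R Z) $ k $ l = sp_projection_unit i j c $ k $ l"
      by simp
    then show ?thesis
      by (simp add: scaleR_conv_of_real[where 'a = complex])
  qed
  \<comment> \<open>The real inner products of a complex number with \<open>1\<close> and
    \<open>\<i>\<close> are its real and imaginary parts, from which the entry is
    reassembled.\<close>
  have "(\<Sum>Z\<in>B. Z $ i $ j * Z $ k $ l)
      = (\<Sum>Z\<in>B. of_real (Z $ i $ j \<bullet> 1) * Z $ k $ l + \<i> * (of_real (Z $ i $ j \<bullet> \<i>) * Z $ k $ l))"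
    by (intro sum.cong refl) (simp add: inner_complex_def complex_eq_iff algebra_simps)
  also have "\<dots> = sp_projection_unit i j 1 $ k $ l + \<i> * sp_projection_unit i j \<i> $ k $ l"
    by (simp only: sum.distrib sum_distrib_left[symmetric] expand)
  also have "\<dots> = - (1 / 2) * ((if k = j \<and> l = i then 1 else 0)
     - (if k = swap_index i \<and> l = swap_index j then index_sign i * index_sign j else 0))"
  proof -
    have scale: "matrix_unit r s c $ k $ l = c * matrix_unit r s 1 $ k $ l" for r s c
      by (simp add: matrix_unit_def)
    have entry: "sp_projection_unit i j c $ k $ l = 1 / 4 * (c * matrix_unit i j 1 $ k $ l
        - cnj c * matrix_unit j i 1 $ k $ l
        + index_sign i * index_sign j * cnj c * matrix_unit (swap_index i) (swap_index j) 1 $ k $ l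
        - index_sign i * index_sign j * c * matrix_unit (swap_index j) (swap_index i) 1 $ k $ l)" for c
      unfolding sp_projection_unit_def
      by (simp add: scale[of _ _ c] scale[of _ _ "cnj c"] scale[of _ _ "_ * _"]
          scaleR_conv_of_real[where 'a = complex])
    \<comment> \<open>The terms linear in \<open>c\<close> cancel, since
      \<open>1 + \<i> * \<i> = 0\<close>; those in \<open>cnj c\<close> double, since
      \<open>1 + \<i> * cnj \<i> = 2\<close>.\<close>
    have "sp_projection_unit i j 1 $ k $ l + \<i> * sp_projection_unit i j \<i> $ k $ l
        = - (1 / 2) * (matrix_unit j i 1 $ k $ l
          - index_sign i * index_sign j * matrix_unit (swap_index i) (swap_index j) 1 $ k $ l)"
      unfolding entry by (simp add: algebra_simps)
    then show ?thesis
      by (simp add: matrix_unit_def)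
  qed
  finally show ?thesis .
qed

lemma casimir_vector:
  fixes v :: "complex ^ ('n::finite + 'n)"
  assumes "sp_orthonormal_basis B"
  shows "(\<Sum>Z\<in>B. Z *v (Z *v v)) = - (of_nat (2 * CARD('n) + 1) / 2) *s v"
proof -
  have "(\<Sum>Z\<in>B. Z *v (Z *v v)) $ i = - (of_nat (2 * CARD('n) + 1) / 2) * v $ i" for i
  proof -
    have "(\<Sum>Z\<in>B. Z *v (Z *v v)) $ i = (\<Sum>Z\<in>B. \<Sum>j\<in>UNIV. \<Sum>l\<in>UNIV. Z $ i $ j * Z $ j $ l * v $ l)"
      by (simp add: matrix_vector_mult_def sum_distrib_left mult.assoc)
    also have "\<dots> = (\<Sum>j\<in>UNIV. \<Sum>l\<in>UNIV. (\<Sum>Z\<in>B. Z $ i $ j * Z $ j $ l) * v $ l)"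
      by (simp add: sum_distrib_right sum.swap[of _ _ B])
    also have "\<dots> = (\<Sum>j\<in>UNIV. \<Sum>l\<in>UNIV. - (1 / 2) * (if l = i then v $ l else 0)
        + 1 / 2 * (if l = swap_index j then
            if j = swap_index i then index_sign i * index_sign j * v $ i else 0 else 0))"
      unfolding sum_basis_entries[OF assms]
    proof (intro sum.cong refl)
      show "- (1 / 2) * ((if j = j \<and> l = i then 1 else 0)
          - (if j = swap_index i \<and> l = swap_index j then index_sign i * index_sign j else 0)) * v $ l
        = - (1 / 2) * (if l = i then v $ l else 0) + 1 / 2 * (if l = swap_index j then
            if j = swap_index i then index_sign i * index_sign j * v $ i else 0 else 0)" for j l
        by (cases "l = i"; cases "j = swap_index i"; cases "l = swap_index j"; simp)
    qed
    \<comment> \<open>The first part contributes once for each of the 2n indices \<open>j\<close>.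
      The second survives only for \<open>j = swap_index i\<close>, where \<open>l = i\<close> and
      the product of the signs is \<open>-1\<close>.\<close>
    also have "\<dots> = - (1 / 2) * (\<Sum>j\<in>(UNIV :: ('n + 'n) set). v $ i) + 1 / 2 * (- v $ i)"
      by (simp only: sum.distrib sum_distrib_left[symmetric]) simp
    also have "\<dots> = - (of_nat (2 * CARD('n) + 1) / 2) * v $ i"
      by (simp add: algebra_simps)
    finally show ?thesis .
  qed
  then show ?thesis
    by (simp add: vec_eq_iff)
qed

text \<open>Bilinear, without conjugation, to match the plain transposes in \<open>phi\<close> and
  the complex bilinear extension of the metric.\<close>

definition cdot :: "complex ^ 'm::finite \<Rightarrow> complex ^ 'm \<Rightarrow> complex" where
  "cdot x v = (\<Sum>r\<in>UNIV. x $ r * v $ r)"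

lemma cdot_matrix_vector: "cdot x (A *v v) = cdot (x v* A) v"
proof -
  have "cdot x (A *v v) = (\<Sum>i\<in>UNIV. \<Sum>j\<in>UNIV. x $ i * (A $ i $ j * v $ j))"
    by (simp add: cdot_def matrix_vector_mult_def sum_distrib_left)
  also have "\<dots> = (\<Sum>j\<in>UNIV. \<Sum>i\<in>UNIV. x $ i * (A $ i $ j * v $ j))"
    by (rule sum.swap)
  also have "\<dots> = cdot (x v* A) v"
    by (simp add: cdot_def vector_matrix_mult_def sum_distrib_right mult.assoc)
  finally show ?thesis .
qed

text \<open>Reindexing by \<open>swap_index\<close> flips the sign of every summand, so the sum
  equals its own negative. This is the vanishing of the alternating form at a pair of equal
  vectors.\<close>

lemma cdot_symplectic_self: "(\<Sum>r\<in>UNIV. index_sign r * x $ r * x $ swap_index r) = 0"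
  using sum_swap_index[of "\<lambda>r. index_sign r * x $ r * x $ swap_index r"]
  by (simp add: sum_negf mult_ac)

lemma casimir_bilinear:
  assumes "sp_orthonormal_basis B"
  shows "(\<Sum>Z\<in>B. cdot x (Z *v v) * cdot x (Z *v u)) = - (1 / 2) * cdot x v * cdot x u"
proof -
  have "(\<Sum>Z\<in>B. cdot x (Z *v v) * cdot x (Z *v u))
      = (\<Sum>Z\<in>B. \<Sum>i\<in>UNIV. \<Sum>k\<in>UNIV. \<Sum>j\<in>UNIV. \<Sum>l\<in>UNIV.
          Z $ i $ j * Z $ k $ l * (x $ i * v $ j * x $ k * u $ l))"
    by (simp add: cdot_def matrix_vector_mult_def sum_product sum_distrib_left mult_ac)
  \<comment> \<open>The sums over \<open>k\<close> and \<open>l\<close> go innermost, because the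
    conditions in \<open>sum_basis_entries\<close> determine these two indices from \<open>i\<close>
    and \<open>j\<close>.\<close>
  also have "\<dots> = (\<Sum>Z\<in>B. \<Sum>i\<in>UNIV. \<Sum>j\<in>UNIV. \<Sum>k\<in>UNIV. \<Sum>l\<in>UNIV.
          Z $ i $ j * Z $ k $ l * (x $ i * v $ j * x $ k * u $ l))"
    by (intro sum.cong refl sum.swap)
  also have "\<dots> = (\<Sum>i\<in>UNIV. \<Sum>j\<in>UNIV. \<Sum>k\<in>UNIV. \<Sum>l\<in>UNIV.
          (\<Sum>Z\<in>B. Z $ i $ j * Z $ k $ l) * (x $ i * v $ j * x $ k * u $ l))"
    by (simp add: sum_distrib_right sum.swap[of _ _ B])
  also have "\<dots> = (\<Sum>i\<in>UNIV. \<Sum>j\<in>UNIV. \<Sum>k\<in>UNIV. \<Sum>l\<in>UNIV.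
        - (1 / 2) * (if l = i then if k = j then x $ i * v $ j * x $ j * u $ i else 0 else 0)
        + 1 / 2 * (if l = swap_index j then if k = swap_index i then
            index_sign i * index_sign j * (x $ i * v $ j * x $ swap_index i * u $ swap_index j)
            else 0 else 0))"
    unfolding sum_basis_entries[OF assms] by (intro sum.cong refl) auto
  also have "\<dots> = - (1 / 2) * (\<Sum>i\<in>UNIV. \<Sum>j\<in>UNIV. x $ i * v $ j * x $ j * u $ i)
      + 1 / 2 * (\<Sum>i\<in>UNIV. \<Sum>j\<in>UNIV.
          index_sign i * index_sign j * (x $ i * v $ j * x $ swap_index i * u $ swap_index j))"
    by (simp only: sum.distrib sum_distrib_left[symmetric]) simp
  also have "(\<Sum>i\<in>UNIV. \<Sum>j\<in>UNIV. x $ i * v $ j * x $ j * u $ i) = cdot x v * cdot x u"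
    unfolding cdot_def sum_product by (subst sum.swap) (simp add: mult_ac)
  \<comment> \<open>The part with J separates into a factor in \<open>x\<close> alone and a factor
    in \<open>v\<close> and \<open>u\<close>. The first vanishes because both pairings share
    \<open>x\<close>.\<close>
  also have "(\<Sum>i\<in>UNIV. \<Sum>j\<in>UNIV.
          index_sign i * index_sign j * (x $ i * v $ j * x $ swap_index i * u $ swap_index j))
      = (\<Sum>i\<in>UNIV. index_sign i * x $ i * x $ swap_index i)
        * (\<Sum>j\<in>UNIV. index_sign j * v $ j * u $ swap_index j)"
    unfolding sum_product by (simp add: mult_ac)
  finally show ?thesis
    by (simp add: cdot_symplectic_self)
qed


section \<open>Matrix coefficients\<close>

definition matrix_coefficient ::
    "complex ^ 'm \<Rightarrow> complex ^ 'm \<Rightarrow> 'm::finite cmat \<Rightarrow> complex" where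
  "matrix_coefficient x v g = cdot x (g *v v)"

lemma bounded_linear_matrix_coefficient: "bounded_linear (matrix_coefficient x v)"
  unfolding linear_conv_bounded_linear[symmetric] matrix_coefficient_def
  by (rule linearI)
    (simp_all add: cdot_def matrix_vector_mult_def sum.distrib algebra_simps scaleR_sum_right
      sum_distrib_left)

text \<open>Agreement of \<open>f\<close> with the coefficient is assumed on \<open>Sp\<close> only,
  and the curve through \<open>g\<close> stays there. The result again describes the derivative on
  \<open>Sp\<close>, so the lemma can be iterated.\<close>

lemma left_deriv_matrix_coefficient:
  assumes f: "\<And>h. h \<in> Sp \<Longrightarrow> f h = matrix_coefficient x v h"
    and "g \<in> Sp" "Z \<in> sp_algebra"
  shows "((\<lambda>t. f (g ** mat_exp (t *\<^sub>R Z))) has_vector_derivative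
           matrix_coefficient x (Z *v v) g) (at 0)"
    and "left_deriv Z f g = matrix_coefficient x (Z *v v) g"
proof -
  have "f (g ** mat_exp (t *\<^sub>R Z)) = matrix_coefficient x v (g ** mat_exp (t *\<^sub>R Z))" for t
    using assms by (intro f Sp_mult) (auto simp: sp_algebra_def)
  moreover have "matrix_coefficient x v (g ** Z) = matrix_coefficient x (Z *v v) g"
    by (simp add: matrix_coefficient_def matrix_vector_mul_assoc)
  ultimately show *: "((\<lambda>t. f (g ** mat_exp (t *\<^sub>R Z))) has_vector_derivative
      matrix_coefficient x (Z *v v) g) (at 0)"
    using has_vector_derivative_mat_exp_linear[OF bounded_linear_matrix_coefficient, of x v g Z] by simp
  show "left_deriv Z f g = matrix_coefficient x (Z *v v) g"
    unfolding left_deriv_def using * by (rule vector_derivative_at)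
qed

lemma foldr_left_deriv_matrix_coefficient:
  assumes f: "\<And>h. h \<in> Sp \<Longrightarrow> f h = matrix_coefficient x v h"
    and "set Zs \<subseteq> sp_algebra" "h \<in> Sp"
  shows "foldr left_deriv Zs f h = matrix_coefficient x (foldr (*v) Zs v) h"
  using assms(2,3)
proof (induction Zs arbitrary: h)
  case (Cons Z Zs)
  then show ?case
    using left_deriv_matrix_coefficient(2)[of "foldr left_deriv Zs f" x "foldr (*v) Zs v" h Z]
    by simp
qed (simp add: f)

text \<open>Every iterated derivative is again a matrix coefficient on \<open>Sp\<close>, hence the
  restriction of a linear function of the matrix.\<close>

lemma smooth_on_Sp_matrix_coefficient:
  assumes f: "\<And>h. h \<in> Sp \<Longrightarrow> f h = matrix_coefficient x v h"
  shows "smooth_on_Sp f"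
  unfolding smooth_on_Sp_def
proof (intro allI impI conjI ballI)
  fix Zs :: "('a + 'a) cmat list"
  assume "set Zs \<subseteq> sp_algebra"
  note eq = foldr_left_deriv_matrix_coefficient[OF f this]
  show "continuous_on Sp (foldr left_deriv Zs f)"
    using linear_continuous_on[OF bounded_linear_matrix_coefficient] eq
    by (simp cong: continuous_on_cong)
  show "(\<lambda>t. foldr left_deriv Zs f (g ** mat_exp (t *\<^sub>R Z))) differentiable (at 0)"
    if "g \<in> Sp" "Z \<in> sp_algebra" for g Z
    using left_deriv_matrix_coefficient(1)[OF eq that] by (auto intro: differentiableI_vector)
qed

section \<open>Eigenvalues of the Laplacian and the conformality operator\<close>

lemma tau_matrix_coefficient:
  fixes x v :: "complex ^ ('n::finite + 'n)"
  assumes f: "\<And>h. h \<in> Sp \<Longrightarrow> f h = matrix_coefficient x v h" and g: "g \<in> Sp"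
  shows "tau f g = - (of_nat (2 * CARD('n) + 1) / 2) * f g"
proof -
  have "(\<Sum>Z\<in>B. left_deriv Z (left_deriv Z f) g) = - (of_nat (2 * CARD('n) + 1) / 2) * f g"
    if B: "sp_orthonormal_basis B" for B
  proof -
    have "left_deriv Z (left_deriv Z f) g = cdot (x v* g) (Z *v (Z *v v))" if "Z \<in> B" for Z
    proof -
      have Z: "Z \<in> sp_algebra"
        using B that by (auto simp: sp_orthonormal_basis_def)
      then have "left_deriv Z (left_deriv Z f) g = matrix_coefficient x (Z *v (Z *v v)) g"
        using foldr_left_deriv_matrix_coefficient[OF f, of "[Z, Z]" g] g by simp
      then show ?thesis
        by (simp add: matrix_coefficient_def cdot_matrix_vector)
    qed
    then have "(\<Sum>Z\<in>B. left_deriv Z (left_deriv Z f) g) = (\<Sum>Z\<in>B. cdot (x v* g) (Z *v (Z *v v)))"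
      by simp
    \<comment> \<open>With \<open>g\<close> absorbed into the left vector, the sum over the basis
      acts on \<open>v\<close> alone.\<close>
    also have "\<dots> = cdot (x v* g) (\<Sum>Z\<in>B. Z *v (Z *v v))"
      by (simp add: cdot_def sum_distrib_left sum.swap[of _ _ B])
    also have "\<dots> = - (of_nat (2 * CARD('n) + 1) / 2) * cdot (x v* g) v"
      unfolding casimir_vector[OF B] by (simp add: cdot_def sum_distrib_left mult_ac sum_negf)
    finally show ?thesis
      using f g by (simp add: matrix_coefficient_def cdot_matrix_vector)
  qed
  then show ?thesis
    unfolding tau_def by (rule the_orthonormal_basis_value)
qed

lemma kappa_matrix_coefficient:
  assumes f: "\<And>h. h \<in> Sp \<Longrightarrow> f h = matrix_coefficient x v h"
    and f': "\<And>h. h \<in> Sp \<Longrightarrow> f' h = matrix_coefficient x u h" and g: "g \<in> Sp"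
  shows "kappa f f' g = - (1 / 2) * f g * f' g"
proof -
  have "(\<Sum>Z\<in>B. left_deriv Z f g * left_deriv Z f' g) = - (1 / 2) * f g * f' g"
    if B: "sp_orthonormal_basis B" for B
  proof -
    have "(\<Sum>Z\<in>B. left_deriv Z f g * left_deriv Z f' g)
        = (\<Sum>Z\<in>B. cdot (x v* g) (Z *v v) * cdot (x v* g) (Z *v u))"
    proof (intro sum.cong refl)
      fix Z assume "Z \<in> B"
      then have "Z \<in> sp_algebra"
        using B by (auto simp: sp_orthonormal_basis_def)
      then show "left_deriv Z f g * left_deriv Z f' g
          = cdot (x v* g) (Z *v v) * cdot (x v* g) (Z *v u)"
        using left_deriv_matrix_coefficient(2)[OF f g] left_deriv_matrix_coefficient(2)[OF f' g]
        by (simp add: matrix_coefficient_def cdot_matrix_vector)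
    qed
    then show ?thesis
      using casimir_bilinear[OF B, of "x v* g" v u] f f' g
      by (simp add: matrix_coefficient_def cdot_matrix_vector)
  qed
  then show ?thesis
    unfolding kappa_def by (rule the_orthonormal_basis_value)
qed

text \<open>The trace of \<open>p^t a z^t\<close> is \<open>p z a^t\<close>, and likewise for
  \<open>b\<close> and \<open>w\<close>. So \<open>p\<close> is padded with zeros to select the
  upper blocks, while \<open>a\<close> and \<open>b\<close> are stacked into the right
  vector.\<close>

lemma phi_eq_matrix_coefficient:
  assumes "g \<in> Sp"
  shows "phi p a b g = matrix_coefficient
    (\<chi> r. case r of Inl i \<Rightarrow> p $ i | Inr i \<Rightarrow> 0) (\<chi> r. case r of Inl i \<Rightarrow> a $ i | Inr i \<Rightarrow> b $ i) g"
proof -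
  have split: "(\<Sum>r\<in>UNIV. h r) = (\<Sum>i\<in>UNIV. h (Inl i)) + (\<Sum>i\<in>UNIV. h (Inr i))"
    for h :: "'a + 'a \<Rightarrow> complex"
    using sum.Plus[of UNIV UNIV h] by simp
  show ?thesis
    using assms
    by (simp add: phi_def matrix_coefficient_def cdot_def split trace_def col_times_row_def
        matrix_matrix_mult_def matrix_vector_mult_def transpose_def rowvector_def upper_left_def
        upper_right_def sum_distrib_left sum.distrib distrib_left mult_ac)
qed

theorem theorem6p2:
  fixes p :: "complex ^ 'n::finite"
  assumes "p \<noteq> 0"
  shows "eigenfamily_on_Sp {phi p a b | a b. True}"
proof -
  have smooth: "smooth_on_Sp (phi p a b)" for a b
    by (rule smooth_on_Sp_matrix_coefficient[OF phi_eq_matrix_coefficient])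
  have tau: "tau (phi p a b) g = - (of_nat (2 * CARD('n) + 1) / 2) * phi p a b g"
    if "g \<in> Sp" for a b g
    by (rule tau_matrix_coefficient[OF phi_eq_matrix_coefficient that])
  \<comment> \<open>Any two members of the family have the same left vector, built from
    \<open>p\<close>, as the conformality computation requires.\<close>
  have kappa: "kappa (phi p a b) (phi p a' b') g = - (1 / 2) * phi p a b g * phi p a' b' g"
    if "g \<in> Sp" for a b a' b' g
    by (rule kappa_matrix_coefficient[OF phi_eq_matrix_coefficient phi_eq_matrix_coefficient that])
  show ?thesis
    unfolding eigenfamily_on_Sp_def using smooth tau kappa by blast
qed

end
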